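(* Let $\Phi$ be a TD system on $V$ of $q$-Racah type with diameter $d\ge1$ and associated nonzero scalars $q,a,b\in\mathbb{K}$, and let $K,B,R,R^\Downarrow,\psi\in\mathrm{End}(V)$ be the associated linear transformations. Let $\Lambda$ be the normalized Casimir element of $U_q(\mathfrak{sl}_2)$. Then the following two elements of $\mathrm{End}(V)$ coincide: (i) the action of $\Lambda$ on $V$ for the $U_q(\mathfrak{sl}_2)$-module structure on $V$ in which $e,f,k,k^{-1}$ act as $(q-q^{-1})^{-1}\psi$, $(q-q^{-1})^{-1}R$, $K$, $K^{-1}$ respectively; (ii) the action of $\Lambda$ on $V$ for the $U_q(\mathfrak{sl}_2)$-module structure on $V$ in which $e,f,k,k^{-1}$ act as $(q-q^{-1})^{-1}\psi$, $(q-q^{-1})^{-1}R^\Downarrow$, $B$, $B^{-1}$ respectively.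
   Context: Let $\mathbb{K}$ be an algebraically closed field, $V$ a nonzero finite-dimensional $\mathbb{K}$-vector space, $\mathrm{End}(V)$ the algebra of linear maps $V\to V$, and $I$ the identity. TD pairs and systems. A tridiagonal (TD) pair on $V$ is an ordered pair $A,A^*\in\mathrm{End}(V)$ such that: (i) each of $A,A^*$ is diagonalizable; (ii) there is an ordering $\{V_i\}_{i=0}^d$ of the eigenspaces of $A$ with $A^*V_i\subseteq V_{i-1}+V_i+V_{i+1}$ for $0\le i\le d$ ($V_{-1}=V_{d+1}=0$); (iii) there is an ordering $\{V_i^*\}_{i=0}^\delta$ of the eigenspaces of $A^*$ with $AV_i^*\subseteq V_{i-1}^*+V_i^*+V_{i+1}^*$ for $0\le i\le \delta$ ($V^*_{-1}=V^*_{\delta+1}=0$); (iv) there is no subspace $W$ with $AW\subseteq W$, $A^*W\subseteq W$, $W\ne0$, $W\neq V$. It is known that $d=\delta$ (the diameter); assume $d\ge1$. Orderings as in (ii), (iii) are called standard. The primitive idempotent for an eigenspace of a diagonalizable map is the projection onto it along the sum of the other eigenspaces; an ordering of the primitive idempotents is standard if the corresponding ordering of eigenspaces is. A TD system on $V$ is a sequence $\Phi=(A;\{E_i\}_{i=0}^d;A^*;\{E_i^*\}_{i=0}^d)$ where $A,A^*$ is a TD pair on $V$ and $\{E_i\}$ (resp. $\{E_i^*\}$) is a standard ordering of the primitive idempotents of $A$ (resp. $A^*$). Let $\theta_i$ (resp. $\theta_i^*$) be the eigenvalue of $A$ (resp. $A^*$) for $E_i$ (resp. $E_i^*$). $\Phi$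 has $q$-Racah type, with scalars $q,a,b$, if $q,a,b\in\mathbb{K}$ are nonzero, $q^4\ne1$, and $\theta_i=aq^{d-2i}+a^{-1}q^{2i-d}$, $\theta_i^*=bq^{d-2i}+b^{-1}q^{2i-d}$ for $0\le i\le d$. Split decompositions. For $0\le i\le d$ let $U_i=(E_0^*V+\cdots+E_i^*V)\cap(E_iV+\cdots+E_dV)$ and $U_i^\Downarrow=(E_0^*V+\cdots+E_i^*V)\cap(E_0V+\cdots+E_{d-i}V)$. It is known that $V=\bigoplus_{i=0}^dU_i=\bigoplus_{i=0}^dU_i^\Downarrow$, with all summands nonzero. For $0\le i\le d/2$ let $K_i=(E_0^*V+\cdots+E_i^*V)\cap(E_iV+\cdots+E_{d-i}V)=U_i\cap U_i^\Downarrow$. The maps. $K\in\mathrm{End}(V)$ acts on $U_i$ as $q^{d-2i}I$, and $B\in\mathrm{End}(V)$ acts on $U_i^\Downarrow$ as $q^{d-2i}I$, for $0\le i\le d$; both are invertible. Put $R=A-aK-a^{-1}K^{-1}$ and $R^\Downarrow=A-a^{-1}B-aB^{-1}$. The map $\psi$ is the element of $\mathrm{End}(V)$, known to exist and be unique, such that $\psi R-R\psi=(q-q^{-1})(K-K^{-1})$ and $\psi K_i=0$ for $0\le i\le d/2$. $U_q(\mathfrak{sl}_2)$ is the unital associative $\mathbb{K}$-algebra with generators $e,f,k,k^{-1}$ and relations $kk^{-1}=k^{-1}k=1$, $kek^{-1}=q^2e$, $kfk^{-1}=q^{-2}f$, $ef-fe=\frac{k-k^{-1}}{q-q^{-1}}$.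 Its normalized Casimir element is $\Lambda=(q-q^{-1})^2ef+q^{-1}k+qk^{-1}=(q-q^{-1})^2fe+qk+q^{-1}k^{-1}$. The assignments in (i) and (ii) of the claim do define $U_q(\mathfrak{sl}_2)$-module structures on $V$. *)

theory Defs
  imports
    "HOL-Computational_Algebra.Polynomial"
    "HOL-Library.Set_Algebras"
    "HOL-Library.Poly_Mapping"
    "HOL-Algebra.QuotRing"
begin

text \<open>
  The vector space \<open>V\<close> is the whole type \<open>'v\<close> with scalar multiplication \<open>sc\<close> over the
  field type \<open>'k\<close>. Sums \<open>W + W'\<close> and \<open>\<Sum>j\<in>J. W j\<close> of subspaces are the elementwise
  ones of \<^theory>\<open>HOL-Library.Set_Algebras\<close>; in particular an empty sum is \<open>{0}\<close>.
\<close>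

section \<open>Tridiagonal pairs and systems\<close>

definition eigenspace ::
    "('k::field \<Rightarrow> 'v::ab_group_add \<Rightarrow> 'v) \<Rightarrow> ('v \<Rightarrow> 'v) \<Rightarrow> 'k \<Rightarrow> 'v set" where
  "eigenspace sc A \<theta> = {v. A v = sc \<theta> v}"

definition eigenspaces ::
    "('k::field \<Rightarrow> 'v::ab_group_add \<Rightarrow> 'v) \<Rightarrow> ('v \<Rightarrow> 'v) \<Rightarrow> 'v set set" where
  "eigenspaces sc A = {eigenspace sc A \<theta> |\<theta>. eigenspace sc A \<theta> \<noteq> {0}}"

definition diagonalizable_map ::
    "('k::field \<Rightarrow> 'v::ab_group_add \<Rightarrow> 'v) \<Rightarrow> ('v \<Rightarrow> 'v) \<Rightarrow> bool" where
  "diagonalizable_map sc A \<longleftrightarrow>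
     Vector_Spaces.linear sc sc A \<and> module.span sc (\<Union>(eigenspaces sc A)) = UNIV"

definition standard_ordering ::
    "('k::field \<Rightarrow> 'v::ab_group_add \<Rightarrow> 'v) \<Rightarrow> ('v \<Rightarrow> 'v) \<Rightarrow> ('v \<Rightarrow> 'v) \<Rightarrow> nat \<Rightarrow> (nat \<Rightarrow> 'v set) \<Rightarrow> bool"
  where
  "standard_ordering sc A As d W \<longleftrightarrow>
     bij_betw W {0..d} (eigenspaces sc A) \<and>
     (\<forall>i\<le>d. As ` W i \<subseteq>
        (if i = 0 then {0} else W (i - 1)) + W i + (if i = d then {0} else W (i + 1)))"

definition td_pair ::
    "('k::field \<Rightarrow> 'v::ab_group_add \<Rightarrow> 'v) \<Rightarrow> ('v \<Rightarrow> 'v) \<Rightarrow> ('v \<Rightarrow> 'v) \<Rightarrow> bool" where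
  "td_pair sc A As \<longleftrightarrow>
     diagonalizable_map sc A \<and> diagonalizable_map sc As \<and>
     (\<exists>d W. standard_ordering sc A As d W) \<and>
     (\<exists>\<delta> W. standard_ordering sc As A \<delta> W) \<and>
     \<not> (\<exists>W. module.subspace sc W \<and> A ` W \<subseteq> W \<and> As ` W \<subseteq> W \<and> W \<noteq> {0} \<and> W \<noteq> UNIV)"

text \<open>\<open>P\<close> is the projection onto the eigenspace \<open>W\<close> of \<open>A\<close> along the sum of the others.\<close>

definition primitive_idempotent ::
    "('k::field \<Rightarrow> 'v::ab_group_add \<Rightarrow> 'v) \<Rightarrow> ('v \<Rightarrow> 'v) \<Rightarrow> 'v set \<Rightarrow> ('v \<Rightarrow> 'v) \<Rightarrow> bool" where
  "primitive_idempotent sc A W P \<longleftrightarrow>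
     Vector_Spaces.linear sc sc P \<and> W \<in> eigenspaces sc A \<and>
     (\<forall>v\<in>W. P v = v) \<and> (\<forall>W'\<in>eigenspaces sc A - {W}. \<forall>v\<in>W'. P v = 0)"

definition standard_idempotents ::
    "('k::field \<Rightarrow> 'v::ab_group_add \<Rightarrow> 'v) \<Rightarrow> ('v \<Rightarrow> 'v) \<Rightarrow> ('v \<Rightarrow> 'v) \<Rightarrow> nat \<Rightarrow> (nat \<Rightarrow> 'v \<Rightarrow> 'v) \<Rightarrow> bool"
  where
  "standard_idempotents sc A As d E \<longleftrightarrow>
     (\<exists>W. standard_ordering sc A As d W \<and> (\<forall>i\<le>d. primitive_idempotent sc A (W i) (E i)))"

definition td_system ::
    "('k::field \<Rightarrow> 'v::ab_group_add \<Rightarrow> 'v) \<Rightarrow> nat \<Rightarrow> ('v \<Rightarrow> 'v) \<Rightarrow> (nat \<Rightarrow> 'v \<Rightarrow> 'v) \<Rightarrow>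
      ('v \<Rightarrow> 'v) \<Rightarrow> (nat \<Rightarrow> 'v \<Rightarrow> 'v) \<Rightarrow> bool" where
  "td_system sc d A E As Es \<longleftrightarrow>
     td_pair sc A As \<and> standard_idempotents sc A As d E \<and> standard_idempotents sc As A d Es"

definition q_racah_type ::
    "('k::field \<Rightarrow> 'v::ab_group_add \<Rightarrow> 'v) \<Rightarrow> nat \<Rightarrow> ('v \<Rightarrow> 'v) \<Rightarrow> (nat \<Rightarrow> 'v \<Rightarrow> 'v) \<Rightarrow>
      ('v \<Rightarrow> 'v) \<Rightarrow> (nat \<Rightarrow> 'v \<Rightarrow> 'v) \<Rightarrow> 'k \<Rightarrow> 'k \<Rightarrow> 'k \<Rightarrow> bool" where
  "q_racah_type sc d A E As Es q a b \<longleftrightarrow>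
     q \<noteq> 0 \<and> a \<noteq> 0 \<and> b \<noteq> 0 \<and> q ^ 4 \<noteq> 1 \<and>
     (\<forall>i\<le>d. range (E i) = eigenspace sc A
        (a * q powi (int d - 2 * int i) + inverse a * q powi (2 * int i - int d))) \<and>
     (\<forall>i\<le>d. range (Es i) = eigenspace sc As
        (b * q powi (int d - 2 * int i) + inverse b * q powi (2 * int i - int d)))"

section \<open>Split decompositions and the associated maps\<close>

definition split_U :: "nat \<Rightarrow> (nat \<Rightarrow> 'v \<Rightarrow> 'v::ab_group_add) \<Rightarrow> (nat \<Rightarrow> 'v \<Rightarrow> 'v) \<Rightarrow> nat \<Rightarrow> 'v set"
  where "split_U d E Es i = (\<Sum>j\<in>{0..i}. range (Es j)) \<inter> (\<Sum>j\<in>{i..d}. range (E j))"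

definition split_U_down :: "nat \<Rightarrow> (nat \<Rightarrow> 'v \<Rightarrow> 'v::ab_group_add) \<Rightarrow> (nat \<Rightarrow> 'v \<Rightarrow> 'v) \<Rightarrow> nat \<Rightarrow> 'v set"
  where "split_U_down d E Es i = (\<Sum>j\<in>{0..i}. range (Es j)) \<inter> (\<Sum>j\<in>{0..d - i}. range (E j))"

definition K_space :: "nat \<Rightarrow> (nat \<Rightarrow> 'v \<Rightarrow> 'v::ab_group_add) \<Rightarrow> (nat \<Rightarrow> 'v \<Rightarrow> 'v) \<Rightarrow> nat \<Rightarrow> 'v set"
  where "K_space d E Es i = (\<Sum>j\<in>{0..i}. range (Es j)) \<inter> (\<Sum>j\<in>{i..d - i}. range (E j))"

text \<open>
  Since \<open>V\<close> is the direct sum of the \<open>U i\<close>, at most one map \<open>X\<close> satisfies the following.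
\<close>

definition acts_on_decomposition ::
    "('k::field \<Rightarrow> 'v::ab_group_add \<Rightarrow> 'v) \<Rightarrow> nat \<Rightarrow> 'k \<Rightarrow> (nat \<Rightarrow> 'v set) \<Rightarrow> ('v \<Rightarrow> 'v) \<Rightarrow> bool" where
  "acts_on_decomposition sc d q U X \<longleftrightarrow>
     Vector_Spaces.linear sc sc X \<and>
     (\<forall>i\<le>d. \<forall>u\<in>U i. X u = sc (q powi (int d - 2 * int i)) u)"

text \<open>\<open>inv_into UNIV K\<close> is the inverse map of \<open>K\<close>; plain \<open>inv\<close> is taken by HOL-Algebra.\<close>

definition is_psi ::
    "('k::field \<Rightarrow> 'v::ab_group_add \<Rightarrow> 'v) \<Rightarrow> nat \<Rightarrow> (nat \<Rightarrow> 'v \<Rightarrow> 'v) \<Rightarrow> (nat \<Rightarrow> 'v \<Rightarrow> 'v) \<Rightarrow> 'k \<Rightarrow>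
      ('v \<Rightarrow> 'v) \<Rightarrow> ('v \<Rightarrow> 'v) \<Rightarrow> ('v \<Rightarrow> 'v) \<Rightarrow> bool" where
  "is_psi sc d E Es q K R \<psi> \<longleftrightarrow>
     Vector_Spaces.linear sc sc \<psi> \<and>
     (\<forall>v. \<psi> (R v) - R (\<psi> v) = sc (q - inverse q) (K v - inv_into UNIV K v)) \<and>
     (\<forall>i. 2 * i \<le> d \<longrightarrow> (\<forall>v\<in>K_space d E Es i. \<psi> v = 0))"

section \<open>The algebra \<open>U\<^sub>q(sl\<^sub>2)\<close> and its modules\<close>

text \<open>
  The free unital associative algebra on four generators is the algebra of the monoid of words,
  i.e. finitely supported functions from words to \<open>'k\<close> with convolution product. As
  \<open>Poly_Mapping\<close> writes the monoid additively, concatenation of words is called \<open>+\<close>.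
\<close>

datatype uq_gen = Gen_e | Gen_f | Gen_k | Gen_kinv

datatype uq_word = Word "uq_gen list"

instantiation uq_word :: monoid_add
begin

definition zero_uq_word :: uq_word where
  "zero_uq_word = Word []"

fun plus_uq_word :: "uq_word \<Rightarrow> uq_word \<Rightarrow> uq_word" where
  "plus_uq_word (Word u) (Word w) = Word (u @ w)"

instance
proof
  fix x y z :: uq_word
  show "x + y + z = x + (y + z)"
    by (cases x; cases y; cases z) simp
  show "0 + x = x" "x + 0 = x"
    by (cases x; simp add: zero_uq_word_def)+
qed

end

type_synonym 'k uq_free = "uq_word \<Rightarrow>\<^sub>0 'k"

definition gen :: "uq_gen \<Rightarrow> 'k::field uq_free" where
  "gen x = Poly_Mapping.single (Word [x]) 1"

definition scal :: "'k::field \<Rightarrow> 'k uq_free" where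
  "scal c = Poly_Mapping.single 0 c"

definition uq_relators :: "'k::field \<Rightarrow> 'k uq_free set" where
  "uq_relators q =
    {gen Gen_k * gen Gen_kinv - 1,
     gen Gen_kinv * gen Gen_k - 1,
     gen Gen_k * gen Gen_e * gen Gen_kinv - scal (q\<^sup>2) * gen Gen_e,
     gen Gen_k * gen Gen_f * gen Gen_kinv - scal (inverse (q\<^sup>2)) * gen Gen_f,
     gen Gen_e * gen Gen_f - gen Gen_f * gen Gen_e
       - scal (inverse (q - inverse q)) * (gen Gen_k - gen Gen_kinv)}"

definition free_ring :: "'k::field uq_free ring" where
  "free_ring = \<lparr>carrier = UNIV, mult = (*), one = 1, zero = 0, add = (+)\<rparr>"

definition uq_ideal :: "'k::field \<Rightarrow> 'k uq_free set" where
  "uq_ideal q = Idl\<^bsub>free_ring\<^esub> (uq_relators q)"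

definition Uq_sl2 :: "'k::field \<Rightarrow> 'k uq_free set ring" where
  "Uq_sl2 q = free_ring Quot uq_ideal q"

definition uq_class :: "'k::field \<Rightarrow> 'k uq_free \<Rightarrow> 'k uq_free set" where
  "uq_class q x = uq_ideal q +>\<^bsub>free_ring\<^esub> x"

definition casimir :: "'k::field \<Rightarrow> 'k uq_free set" where
  "casimir q = uq_class q
     (scal ((q - inverse q)\<^sup>2) * gen Gen_e * gen Gen_f
      + scal (inverse q) * gen Gen_k + scal q * gen Gen_kinv)"

definition End_ring :: "('k::field \<Rightarrow> 'v::ab_group_add \<Rightarrow> 'v) \<Rightarrow> ('v \<Rightarrow> 'v) ring" where
  "End_ring sc =
    \<lparr>carrier = {f. Vector_Spaces.linear sc sc f}, mult = (\<circ>), one = id,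
     zero = (\<lambda>_. 0), add = (\<lambda>f g v. f v + g v)\<rparr>"

text \<open>
  A module structure on \<open>V\<close> is a homomorphism of unital algebras into \<open>End(V)\<close>; for a unital ring
  homomorphism, linearity over \<open>'k\<close> amounts to the correct values on the scalar multiples of 1.
\<close>

definition uq_module ::
    "('k::field \<Rightarrow> 'v::ab_group_add \<Rightarrow> 'v) \<Rightarrow> 'k \<Rightarrow> ('k uq_free set \<Rightarrow> 'v \<Rightarrow> 'v) \<Rightarrow> bool" where
  "uq_module sc q \<rho> \<longleftrightarrow>
     \<rho> \<in> ring_hom (Uq_sl2 q) (End_ring sc) \<and> (\<forall>c. \<rho> (uq_class q (scal c)) = sc c)"

definition uq_module_via ::
    "('k::field \<Rightarrow> 'v::ab_group_add \<Rightarrow> 'v) \<Rightarrow> 'k \<Rightarrow> ('k uq_free set \<Rightarrow> 'v \<Rightarrow> 'v) \<Rightarrow>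
      ('v \<Rightarrow> 'v) \<Rightarrow> ('v \<Rightarrow> 'v) \<Rightarrow> ('v \<Rightarrow> 'v) \<Rightarrow> ('v \<Rightarrow> 'v) \<Rightarrow> bool" where
  "uq_module_via sc q \<rho> e f k ki \<longleftrightarrow>
     uq_module sc q \<rho> \<and>
     \<rho> (uq_class q (gen Gen_e)) = e \<and> \<rho> (uq_class q (gen Gen_f)) = f \<and>
     \<rho> (uq_class q (gen Gen_k)) = k \<and> \<rho> (uq_class q (gen Gen_kinv)) = ki"

end

theory Submission
  imports Defs
begin

text \<open>
  By the definitions of \<open>R\<close> and \<open>R\<^sup>\<Down>\<close>,
  \<open>A = R + aK + a\<inverse>K\<inverse> = R\<^sup>\<Down> + a\<inverse>B + aB\<inverse>\<close>. So \<open>A\<close> is a linear combination of actions of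
  \<open>f\<close>, \<open>k\<close>, \<open>k\<inverse>\<close> in either module structure, and since the Casimir element is central, both of its
  actions commute with \<open>A\<close>. The vectors on which the two actions agree therefore form an
  \<open>A\<close>-invariant subspace. This subspace contains every \<open>K\<^sub>i\<close>: there \<open>\<psi>\<close> vanishes, \<open>K\<close> and \<open>B\<close> are the
  same scalar \<open>t = q\<^bsup>d-2i\<^esup>\<close>, and on a vector killed by \<open>e\<close> with \<open>k\<close>-eigenvalue \<open>t\<close> the Casimir element
  is \<open>qt + q\<inverse>t\<inverse>\<close> in any module (lemma \<open>casimir_map_highest_weight\<close>).

  It remains to see that no proper \<open>A\<close>-invariant subspace contains all the \<open>K\<^sub>i\<close> (lemma
  \<open>K_spaces_generate\<close>), which is a statement about the tridiagonal pair alone. Irreducibility makes the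
  \<open>U\<^sub>i\<close> span \<open>V\<close>, and makes \<open>E\<^sup>*\<^sub>0V + \<cdots> + E\<^sup>*\<^sub>iV\<close> meet \<open>E\<^sub>0V + \<cdots> + E\<^sub>jV\<close> trivially when \<open>i + j < d\<close>, which yields the
  injectivity of \<open>(A - \<theta>\<^sub>i)\<cdots>(A - \<theta>\<^bsub>d-i-1\<^esub>)\<close> from \<open>U\<^sub>i\<close> to \<open>U\<^bsub>d-i\<^esub>\<close> for \<open>2i \<le> d\<close>. Applied to the pair with the roles
  of \<open>A\<close> and \<open>A\<^sup>*\<close> exchanged, the same argument bounds the dimensions the other way, so this map is
  bijective. As in the representation theory of \<open>sl\<^sub>2\<close>, it follows that \<open>U\<^bsub>i+1\<^esub> = K\<^bsub>i+1\<^esub> + (A - \<theta>\<^sub>i)U\<^sub>i\<close>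
  in the lower half, because \<open>K\<^sub>i\<close> is the kernel on \<open>U\<^sub>i\<close> of that product with one more factor
  \<open>A - \<theta>\<^bsub>d-i\<^esub>\<close>; the upper half consists of the images of the lower half.
\<close>

section \<open>Sums of eigenspaces\<close>

lemmas linear_module_hom = Vector_Spaces.linear.axioms(3)
lemmas linear_add = linear_module_hom[THEN module_hom.add]
lemmas linear_scale = linear_module_hom[THEN module_hom.scale]
lemmas linear_diff = linear_module_hom[THEN module_hom.diff]
lemmas linear_zero = linear_module_hom[THEN module_hom.zero]
lemmas linear_sum = linear_module_hom[THEN module_hom.sum]

text \<open>
  Membership in a sum of eigenspaces is tested by the vanishing of the complementary components.
  In this form intersections of such sums, and their images under a polynomial in the map, are
  computed on the index sets alone.
\<close>

definition spectral_sum :: "nat \<Rightarrow> (nat \<Rightarrow> 'v \<Rightarrow> 'v::ab_group_add) \<Rightarrow> nat set \<Rightarrow> 'v set" where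
  "spectral_sum d E J = {v. \<forall>k\<le>d. k \<notin> J \<longrightarrow> E k v = 0}"

lemma spectral_sum_mono:
  "J \<inter> {..d} \<subseteq> J' \<Longrightarrow> spectral_sum d E J \<subseteq> spectral_sum d E J'"
  unfolding spectral_sum_def by blast

lemma spectral_sum_weaken:
  "v \<in> spectral_sum d E J \<Longrightarrow> J \<inter> {..d} \<subseteq> J' \<Longrightarrow> v \<in> spectral_sum d E J'"
  using spectral_sum_mono by blast

lemma spectral_sum_rev:
  "spectral_sum d (\<lambda>i. E (d - i)) J = spectral_sum d E {k. d - k \<in> J}"
  unfolding spectral_sum_def
  by (auto, metis diff_diff_cancel diff_le_self)

locale spectral_resolution = vector_space sc
  for sc :: "'k::field \<Rightarrow> 'v::ab_group_add \<Rightarrow> 'v" +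
  fixes d :: nat and A :: "'v \<Rightarrow> 'v" and E :: "nat \<Rightarrow> 'v \<Rightarrow> 'v" and \<theta> :: "nat \<Rightarrow> 'k"
  assumes linear_map: "Vector_Spaces.linear sc sc A"
    and linear_idem: "i \<le> d \<Longrightarrow> Vector_Spaces.linear sc sc (E i)"
    and idem_idem: "i \<le> d \<Longrightarrow> j \<le> d \<Longrightarrow> E i (E j v) = (if i = j then E i v else 0)"
    and sum_idem: "(\<Sum>i\<le>d. E i v) = v"
    and map_idem: "i \<le> d \<Longrightarrow> A (E i v) = sc (\<theta> i) (E i v)"
    and eigenvalues_inj: "i \<le> d \<Longrightarrow> j \<le> d \<Longrightarrow> \<theta> i = \<theta> j \<Longrightarrow> i = j"
    and idem_nonzero: "i \<le> d \<Longrightarrow> \<exists>v. E i v \<noteq> 0"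
begin

lemma idem_map: assumes "i \<le> d" shows "E i (A v) = sc (\<theta> i) (E i v)"
proof -
  have "E i (A v) = E i (A (\<Sum>j\<le>d. E j v))" by (simp add: sum_idem)
  also have "\<dots> = (\<Sum>j\<le>d. sc (\<theta> j) (E i (E j v)))"
    using assms by (simp add: linear_sum[OF linear_map] linear_sum[OF linear_idem] map_idem
        linear_scale[OF linear_idem])
  also have "\<dots> = (\<Sum>j\<le>d. if j = i then sc (\<theta> i) (E i v) else 0)"
    using assms by (intro sum.cong) (auto simp: idem_idem)
  finally show ?thesis using assms by simp
qed

lemma idem_shift:
  "k \<le> d \<Longrightarrow> E k (A v - sc t v) = sc (\<theta> k - t) (E k v)"
  by (simp add: linear_diff[OF linear_idem] linear_scale[OF linear_idem] idem_map
      scale_left_diff_distrib)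

lemma subspace_spectral_sum: "subspace (spectral_sum d E J)"
  unfolding subspace_def spectral_sum_def
  by (simp add: linear_zero[OF linear_idem] linear_add[OF linear_idem]
      linear_scale[OF linear_idem])

text \<open>
  Because \<open>A - \<theta>\<^sub>j\<close> acts on the \<open>k\<close>-th component as \<open>\<theta>\<^sub>k - \<theta>\<^sub>j\<close>, which is zero for \<open>k = j\<close> only, it removes
  exactly the index \<open>j\<close>. The direction from right to left says where \<open>A - \<theta>\<^sub>j\<close> maps a sum of
  eigenspaces, the other one locates its kernel.
\<close>

lemma shift_spectral_sum:
  assumes "j \<le> d"
  shows "A v - sc (\<theta> j) v \<in> spectral_sum d E J \<longleftrightarrow> v \<in> spectral_sum d E (insert j J)"
  using assms eigenvalues_inj unfolding spectral_sum_def
  by (auto simp: idem_shift)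

lemma spectral_sum_all: "spectral_sum d E J = UNIV" if "{..d} \<subseteq> J"
  using that by (auto simp: spectral_sum_def)

lemma spectral_sum_disjoint:
  assumes "v \<in> spectral_sum d E J" "J \<inter> {..d} = {}"
  shows "v = 0"
proof -
  have "\<forall>k\<le>d. E k v = 0" using assms by (auto simp: spectral_sum_def)
  then show ?thesis using sum_idem[of v] by simp
qed

lemma spectral_sum_nontrivial:
  assumes "j \<in> J" "j \<le> d"
  shows "\<exists>v\<in>spectral_sum d E J. v \<noteq> 0"
proof -
  obtain v where "E j v \<noteq> 0" using idem_nonzero assms by blast
  moreover have "E j v \<in> spectral_sum d E J"
    using assms by (auto simp: spectral_sum_def idem_idem)
  ultimately show ?thesis by blast
qed

lemma sum_ranges_eq_spectral_sum:
  assumes J: "J \<subseteq> {..d}"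
  shows "(\<Sum>j\<in>J. range (E j)) = spectral_sum d E J"
proof -
  have fin: "finite J" using J finite_subset by blast
  show ?thesis
  proof (intro equalityI subsetI)
    fix v assume "v \<in> (\<Sum>j\<in>J. range (E j))"
    then obtain s where v: "v = sum s J" and s: "\<forall>j\<in>J. s j \<in> range (E j)"
      unfolding set_sum_alt[OF fin] by blast
    have "E k (s j) = 0" if "j \<in> J" "k \<le> d" "k \<notin> J" for j k
      using s that J idem_idem[of k j] by (force split: if_splits)
    then show "v \<in> spectral_sum d E J"
      unfolding spectral_sum_def v by (auto simp: linear_sum[OF linear_idem])
  next
    fix v assume v: "v \<in> spectral_sum d E J"
    have "v = (\<Sum>j\<le>d. E j v)" by (simp add: sum_idem)
    also have "\<dots> = (\<Sum>j\<in>J. E j v)"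
      using v J by (intro sum.mono_neutral_right) (auto simp: spectral_sum_def)
    finally show "v \<in> (\<Sum>j\<in>J. range (E j))"
      unfolding set_sum_alt[OF fin] by blast
  qed
qed

text \<open>
  The product \<open>(A - \<theta>\<^bsub>i+n-1\<^esub>)\<cdots>(A - \<theta>\<^sub>i)\<close>. On a vector of \<open>U\<^sub>i\<close> it is the \<open>n\<close>-th power of the raising map \<open>R\<close>.
\<close>

fun ladder :: "nat \<Rightarrow> nat \<Rightarrow> 'v \<Rightarrow> 'v" where
  "ladder i 0 v = v"
| "ladder i (Suc n) v = A (ladder i n v) - sc (\<theta> (i + n)) (ladder i n v)"

lemma linear_ladder: "Vector_Spaces.linear sc sc (ladder i n)"
proof (induction n)
  case 0
  show ?case using linear_id by (simp add: id_def)
next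
  case (Suc n)
  show ?case
    by unfold_locales
      (simp_all add: linear_add[OF Suc] linear_scale[OF Suc] linear_add[OF linear_map]
        linear_scale[OF linear_map] scale_right_distrib scale_right_diff_distrib
        scale_left_commute)
qed

lemma ladder_spectral_sum:
  assumes "i + n \<le> Suc d"
  shows "ladder i n v \<in> spectral_sum d E J \<longleftrightarrow> v \<in> spectral_sum d E (J \<union> {i..<i + n})"
  using assms
proof (induction n arbitrary: J)
  case 0
  then show ?case by simp
next
  case (Suc n)
  have "insert (i + n) J \<union> {i..<i + n} = J \<union> {i..<i + Suc n}" by auto
  then show ?case using Suc shift_spectral_sum[of "i + n"] by simp
qed

lemma ladder_closed:
  assumes "subspace D" "A ` D \<subseteq> D" "v \<in> D"
  shows "ladder i n v \<in> D"
  using assms by (induction n) (auto intro!: subspace_diff subspace_scale)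

text \<open>
  Reversing the order of the eigenspaces is one of the symmetries under which the theory of
  tridiagonal pairs is stable; together with exchanging the two maps it yields all of them.
\<close>

lemma reverse:
  "spectral_resolution sc d A (\<lambda>i. E (d - i)) (\<lambda>i. \<theta> (d - i))"
proof (rule spectral_resolution.intro[OF vector_space_axioms],
    rule spectral_resolution_axioms.intro)
  fix v
  show "(\<Sum>i\<le>d. E (d - i) v) = v"
    using sum.nat_diff_reindex[of "\<lambda>i. E i v" "Suc d"] sum_idem[of v]
    by (simp add: lessThan_Suc_atMost)
next
  fix i j v assume "i \<le> d" "j \<le> d"
  then show "E (d - i) (E (d - j) v) = (if i = j then E (d - i) v else 0)"
    by (auto simp: idem_idem)
next
  fix i j assume "i \<le> d" "j \<le> d" "\<theta> (d - i) = \<theta> (d - j)"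
  then show "i = j" using eigenvalues_inj[of "d - i" "d - j"] by simp
qed (simp_all add: linear_map linear_idem map_idem idem_nonzero)

end

section \<open>Two maps acting tridiagonally on each other's eigenspaces\<close>

text \<open>
  A tridiagonal system in terms of its idempotents. The condition that the second map sends an
  eigenspace into its neighbours is the vanishing of the far entries \<open>E\<^sub>i A\<^sup>* E\<^sub>j\<close>.
\<close>

locale tridiagonal_resolution =
  finite_dimensional_vector_space sc Basis +
  A: spectral_resolution sc d A E \<theta> + As: spectral_resolution sc d As Es \<theta>s
  for sc :: "'k::field \<Rightarrow> 'v::ab_group_add \<Rightarrow> 'v" and Basis d A E \<theta> As Es \<theta>s +
  assumes tridiag: "i \<le> d \<Longrightarrow> j \<le> d \<Longrightarrow> Suc i < j \<or> Suc j < i \<Longrightarrow> E i (As (E j v)) = 0"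
    and tridiag_dual: "i \<le> d \<Longrightarrow> j \<le> d \<Longrightarrow> Suc i < j \<or> Suc j < i \<Longrightarrow> Es i (A (Es j v)) = 0"
    and irreducible: "subspace W \<Longrightarrow> A ` W \<subseteq> W \<Longrightarrow> As ` W \<subseteq> W \<Longrightarrow> W = {0} \<or> W = UNIV"
begin

lemma swap: "tridiagonal_resolution sc Basis d As Es \<theta>s A E \<theta>"
  by (intro tridiagonal_resolution.intro[OF finite_dimensional_vector_space_axioms
        As.spectral_resolution_axioms A.spectral_resolution_axioms]
      tridiagonal_resolution_axioms.intro tridiag tridiag_dual irreducible)

lemma reverse: "tridiagonal_resolution sc Basis d A (\<lambda>i. E (d - i)) (\<lambda>i. \<theta> (d - i)) As Es \<theta>s"
proof (rule tridiagonal_resolution.intro[OF finite_dimensional_vector_space_axioms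
      A.reverse As.spectral_resolution_axioms], rule tridiagonal_resolution_axioms.intro)
  fix i j v assume "i \<le> d" "j \<le> d" "Suc i < j \<or> Suc j < i"
  then show "E (d - i) (As (E (d - j) v)) = 0" by (intro tridiag) auto
qed (simp_all add: tridiag_dual irreducible)

lemma reverse_both:
  "tridiagonal_resolution sc Basis d A (\<lambda>i. E (d - i)) (\<lambda>i. \<theta> (d - i))
     As (\<lambda>i. Es (d - i)) (\<lambda>i. \<theta>s (d - i))"
  using tridiagonal_resolution.swap[OF tridiagonal_resolution.reverse[OF
        tridiagonal_resolution.swap[OF reverse]]] .

lemma dual_map_spectral_sum:
  assumes v: "v \<in> spectral_sum d E J"
    and nb: "\<And>j k. j \<in> J \<Longrightarrow> j \<le> d \<Longrightarrow> k \<le> d \<Longrightarrow> j \<le> Suc k \<Longrightarrow> k \<le> Suc j \<Longrightarrow> k \<in> J'"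
  shows "As v \<in> spectral_sum d E J'"
  unfolding spectral_sum_def
proof (intro CollectI allI impI)
  fix k assume k: "k \<le> d" "k \<notin> J'"
  have "E k (As v) = E k (As (\<Sum>j\<le>d. E j v))" by (simp add: A.sum_idem)
  also have "\<dots> = (\<Sum>j\<le>d. E k (As (E j v)))"
    using k by (simp add: linear_sum[OF As.linear_map] linear_sum[OF A.linear_idem])
  also have "\<dots> = 0"
  proof (rule sum.neutral, rule ballI)
    fix j assume j: "j \<in> {..d}"
    show "E k (As (E j v)) = 0"
    proof (cases "j \<in> J")
      case True
      then have "\<not> (j \<le> Suc k \<and> k \<le> Suc j)" using nb[of j k] k j by blast
      then have "Suc k < j \<or> Suc j < k" by linarith
      then show ?thesis using tridiag k j by simp
    next
      case False
      then have "E j v = 0" using v j by (simp add: spectral_sum_def)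
      then show ?thesis
        using k by (simp add: linear_zero[OF As.linear_map] linear_zero[OF A.linear_idem])
    qed
  qed
  finally show "E k (As v) = 0" .
qed

end

section \<open>The split decomposition\<close>

text \<open>
  The flag of \<open>A\<^sup>*\<close>-eigenspaces taken from below meets the flag of \<open>A\<close>-eigenspaces taken from above.
  The diagonal \<open>i = j\<close> gives the split decomposition \<open>U\<^sub>i\<close>; the other positions are needed to show
  that there is nothing strictly above the diagonal. Unbounded intervals keep the definition meaningful for
  indices beyond \<open>d\<close>.
\<close>

definition flag_meet ::
    "nat \<Rightarrow> (nat \<Rightarrow> 'v \<Rightarrow> 'v::ab_group_add) \<Rightarrow> (nat \<Rightarrow> 'v \<Rightarrow> 'v) \<Rightarrow> nat \<Rightarrow> nat \<Rightarrow> 'v set" where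
  "flag_meet d E Es i j = spectral_sum d Es {..i} \<inter> spectral_sum d E {j..}"

context tridiagonal_resolution
begin

lemma subspace_flag_meet: "subspace (flag_meet d E Es i j)"
  unfolding flag_meet_def
  by (intro subspace_inter A.subspace_spectral_sum As.subspace_spectral_sum)

lemma raise_flag_meet:
  assumes v: "v \<in> flag_meet d E Es i j" and j: "j \<le> d"
  shows "A v - sc (\<theta> j) v \<in> flag_meet d E Es (Suc i) (Suc j)"
proof -
  interpret swap: tridiagonal_resolution sc Basis d As Es \<theta>s A E \<theta> by (rule swap)
  have v': "v \<in> spectral_sum d Es {..i}" "v \<in> spectral_sum d E {j..}"
    using v by (auto simp: flag_meet_def)
  have "A v \<in> spectral_sum d Es {..Suc i}"
    by (rule swap.dual_map_spectral_sum[OF v'(1)]) auto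
  moreover have "v \<in> spectral_sum d Es {..Suc i}"
    using v'(1) by (rule spectral_sum_weaken) auto
  ultimately have "A v - sc (\<theta> j) v \<in> spectral_sum d Es {..Suc i}"
    by (intro subspace_diff subspace_scale As.subspace_spectral_sum)
  moreover have "insert j {Suc j..} = {j..}" by auto
  then have "A v - sc (\<theta> j) v \<in> spectral_sum d E {Suc j..}"
    using v'(2) by (simp add: A.shift_spectral_sum[OF j])
  ultimately show ?thesis by (simp add: flag_meet_def)
qed

lemma raise_flag_meet_top:
  assumes v: "v \<in> flag_meet d E Es i j" and j: "d \<le> j"
  shows "A v - sc (\<theta> d) v = 0"
proof -
  have "v \<in> spectral_sum d E (insert d {})"
    using v j by (auto simp: flag_meet_def elim!: spectral_sum_weaken)
  then have "A v - sc (\<theta> d) v \<in> spectral_sum d E {}"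
    using A.shift_spectral_sum[of d v "{}"] by simp
  then show ?thesis by (rule A.spectral_sum_disjoint) simp
qed

lemma lower_flag_meet:
  assumes v: "v \<in> flag_meet d E Es (Suc i) (Suc j)" and i: "Suc i \<le> d"
  shows "As v - sc (\<theta>s (Suc i)) v \<in> flag_meet d E Es i j"
proof -
  have v': "v \<in> spectral_sum d Es {..Suc i}" "v \<in> spectral_sum d E {Suc j..}"
    using v by (auto simp: flag_meet_def)
  have "As v \<in> spectral_sum d E {j..}"
    by (rule dual_map_spectral_sum[OF v'(2)]) auto
  moreover have "v \<in> spectral_sum d E {j..}"
    using v'(2) by (rule spectral_sum_weaken) auto
  ultimately have "As v - sc (\<theta>s (Suc i)) v \<in> spectral_sum d E {j..}"
    by (intro subspace_diff subspace_scale A.subspace_spectral_sum)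
  moreover have "insert (Suc i) {..i} = {..Suc i}" by auto
  then have "As v - sc (\<theta>s (Suc i)) v \<in> spectral_sum d Es {..i}"
    using v'(1) As.shift_spectral_sum[OF i, of v "{..i}"] by simp
  ultimately show ?thesis by (simp add: flag_meet_def)
qed

lemma lower_flag_meet_bottom:
  assumes v: "v \<in> flag_meet d E Es 0 j"
  shows "As v - sc (\<theta>s 0) v = 0"
proof -
  have "v \<in> spectral_sum d Es (insert 0 {})"
    using v by (simp add: flag_meet_def)
  then have "As v - sc (\<theta>s 0) v \<in> spectral_sum d Es {}"
    using As.shift_spectral_sum[of 0 v "{}"] by simp
  then show ?thesis by (rule As.spectral_sum_disjoint) simp
qed

text \<open>
  The map \<open>A\<close> shifted by an eigenvalue moves up along the diagonal and \<open>A\<^sup>*\<close> shifted by an eigenvalue moves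
  down, so the span of each diagonal is invariant under both maps.
\<close>

lemma flag_meet_diagonal_span:
  fixes r :: nat
  defines "W \<equiv> span (\<Union>i\<le>d. flag_meet d E Es i (i + r))"
  shows "W = {0} \<or> W = UNIV"
proof (rule irreducible)
  let ?F = "\<Union>i\<le>d. flag_meet d E Es i (i + r)"
  show sW: "subspace W" by (simp add: W_def)
  have base: "v \<in> W" if "v \<in> flag_meet d E Es i (i + r)" "i \<le> d" for i v
    unfolding W_def using that by (intro span_base) auto
  have step: "X ` W \<subseteq> W" if X: "Vector_Spaces.linear sc sc X"
    and *: "\<And>i v. i \<le> d \<Longrightarrow> v \<in> flag_meet d E Es i (i + r) \<Longrightarrow> \<exists>t. X v - sc t v \<in> W" for X
  proof -
    have "X v \<in> W" if "v \<in> ?F" for v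
    proof -
      obtain i where i: "i \<le> d" "v \<in> flag_meet d E Es i (i + r)"
        using \<open>v \<in> ?F\<close> by blast
      obtain t where "X v - sc t v \<in> W" using *[OF i] by blast
      then have "(X v - sc t v) + sc t v \<in> W"
        using base[OF i(2,1)] sW by (intro subspace_add subspace_scale)
      then show ?thesis by simp
    qed
    then have "X ` ?F \<subseteq> W" by blast
    then have "span (X ` ?F) \<subseteq> W" using sW by (rule span_minimal)
    moreover have "X ` span ?F = span (X ` ?F)"
      using module_hom.span_image[OF linear_module_hom[OF X]] by simp
    ultimately show ?thesis by (simp add: W_def)
  qed
  show "A ` W \<subseteq> W"
  proof (rule step[OF A.linear_map])
    fix i v assume i: "i \<le> d" and v: "v \<in> flag_meet d E Es i (i + r)"
    show "\<exists>t. A v - sc t v \<in> W"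
    proof (cases "i + r < d")
      case True
      then show ?thesis using raise_flag_meet[OF v] base[of _ "Suc i"] by auto
    next
      case False
      then show ?thesis using raise_flag_meet_top[OF v] subspace_0[OF sW]
        by (metis not_less)
    qed
  qed
  show "As ` W \<subseteq> W"
  proof (rule step[OF As.linear_map])
    fix i v assume i: "i \<le> d" and v: "v \<in> flag_meet d E Es i (i + r)"
    show "\<exists>t. As v - sc t v \<in> W"
    proof (cases i)
      case 0
      then show ?thesis using lower_flag_meet_bottom v subspace_0[OF sW] by metis
    next
      case (Suc h)
      then show ?thesis using lower_flag_meet[of v h "h + r"] v i base[of _ h] by auto
    qed
  qed
qed

text \<open>
  The span of the diagonal \<open>j = i + r\<close> with \<open>r > 0\<close> has no component in the eigenspace of \<open>\<theta>\<^sub>0\<close>, so it is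
  proper and irreducibility leaves only \<open>{0}\<close>.
\<close>

lemma flag_meet_trivial:
  assumes "i < j"
  shows "flag_meet d E Es i j \<subseteq> {0}"
proof (cases "i \<le> d")
  case False
  show ?thesis
  proof
    fix v assume "v \<in> flag_meet d E Es i j"
    then have "v \<in> spectral_sum d E {j..}" by (simp add: flag_meet_def)
    then have "v = 0" by (rule A.spectral_sum_disjoint) (use False assms in auto)
    then show "v \<in> {0}" by simp
  qed
next
  case True
  define r where "r = j - i"
  let ?W = "span (\<Union>i\<le>d. flag_meet d E Es i (i + r))"
  have r: "j = i + r" "r > 0" using assms by (auto simp: r_def)
  have "flag_meet d E Es h (h + r) \<subseteq> spectral_sum d E {1..}" for h
    unfolding flag_meet_def using r(2) by (auto elim!: spectral_sum_weaken)
  then have "(\<Union>i\<le>d. flag_meet d E Es i (i + r)) \<subseteq> spectral_sum d E {1..}" by blast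
  then have sub: "?W \<subseteq> spectral_sum d E {1..}"
    using A.subspace_spectral_sum by (rule span_minimal)
  obtain v where v: "E 0 v \<noteq> 0" using A.idem_nonzero by blast
  then have "v \<notin> spectral_sum d E {1..}" by (auto simp: spectral_sum_def)
  then have "?W = {0}" using flag_meet_diagonal_span[of r] sub by auto
  moreover have "flag_meet d E Es i j \<subseteq> ?W"
    using True r by (auto intro!: span_base)
  ultimately show ?thesis by simp
qed

text \<open>
  The main diagonal begins with the full eigenspace of \<open>\<theta>\<^sup>*\<^sub>0\<close>, so its span is not \<open>{0}\<close>.
\<close>

lemma flag_meet_span_UNIV: "span (\<Union>i\<le>d. flag_meet d E Es i i) = UNIV"
proof -
  obtain v where v: "v \<in> spectral_sum d Es {..0}" "v \<noteq> 0"
    using As.spectral_sum_nontrivial[of 0 "{..0}"] by auto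
  then have "v \<in> flag_meet d E Es 0 0" using A.spectral_sum_all[of "{0..}"]
    by (simp add: flag_meet_def)
  then have "v \<in> span (\<Union>i\<le>d. flag_meet d E Es i i)" by (intro span_base) auto
  then show ?thesis using v(2) flag_meet_diagonal_span[of 0] by auto
qed

section \<open>Generation by the spaces K\<close>

lemma ladder_flag_meet:
  assumes "v \<in> flag_meet d E Es i i" "i + n \<le> d"
  shows "A.ladder i n v \<in> flag_meet d E Es (i + n) (i + n)"
  using assms by (induction n) (auto intro!: raise_flag_meet)

text \<open>
  The kernel of \<open>(A - \<theta>\<^sub>i)\<cdots>(A - \<theta>\<^bsub>d-i-1\<^esub>)\<close> only involves eigenspaces below \<open>d - i\<close>. In the reversed order of
  the eigenspaces of \<open>A\<close> these lie strictly above \<open>i\<close>, which puts the kernel on \<open>U\<^sub>i\<close> strictly above the diagonal.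
\<close>

lemma ladder_kernel_trivial:
  assumes v: "v \<in> flag_meet d E Es i i" and i: "2 * i \<le> d"
    and 0: "A.ladder i (d - 2 * i) v = 0"
  shows "v = 0"
proof (cases "2 * i = d")
  case True
  then show ?thesis using 0 by simp
next
  case False
  interpret rev: tridiagonal_resolution sc Basis d A "\<lambda>i. E (d - i)" "\<lambda>i. \<theta> (d - i)" As Es \<theta>s
    by (rule reverse)
  have "A.ladder i (d - 2 * i) v \<in> spectral_sum d E {}"
    using 0 subspace_0[OF A.subspace_spectral_sum] by metis
  then have "v \<in> spectral_sum d E {i..<d - i}"
    using i A.ladder_spectral_sum[of i "d - 2 * i" v "{}"] by simp
  moreover have "{i..<d - i} \<inter> {..d} \<subseteq> {k. d - k \<in> {Suc i..}}" by auto
  ultimately have "v \<in> spectral_sum d (\<lambda>i. E (d - i)) {Suc i..}"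
    unfolding spectral_sum_rev using spectral_sum_mono by blast
  then have "v \<in> flag_meet d (\<lambda>i. E (d - i)) Es i (Suc i)"
    using v by (simp add: flag_meet_def)
  then show ?thesis using rev.flag_meet_trivial[of i "Suc i"] by auto
qed

lemma ladder_inj_on:
  assumes "2 * i \<le> d"
  shows "inj_on (A.ladder i (d - 2 * i)) (flag_meet d E Es i i)"
proof (rule inj_onI)
  fix v w assume vw: "v \<in> flag_meet d E Es i i" "w \<in> flag_meet d E Es i i"
    and eq: "A.ladder i (d - 2 * i) v = A.ladder i (d - 2 * i) w"
  have "v - w = 0"
  proof (rule ladder_kernel_trivial[OF _ assms])
    show "v - w \<in> flag_meet d E Es i i" using vw by (rule subspace_diff[OF subspace_flag_meet])
    show "A.ladder i (d - 2 * i) (v - w) = 0"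
      using eq by (simp add: linear_diff[OF A.linear_ladder])
  qed
  then show "v = w" by simp
qed

lemma dim_le_via_ladder:
  assumes i: "2 * i \<le> d"
  shows "dim (flag_meet d E Es i i) \<le> dim (flag_meet d E Es (d - i) (d - i))"
proof -
  have sp: "span (flag_meet d E Es i i) = flag_meet d E Es i i"
    using subspace_flag_meet by (simp add: span_eq_iff)
  interpret pair: finite_dimensional_vector_space_pair sc Basis sc Basis by unfold_locales
  have "dim (A.ladder i (d - 2 * i) ` flag_meet d E Es i i) = dim (flag_meet d E Es i i)"
    by (rule pair.dim_image_eq[OF A.linear_ladder]) (simp only: sp ladder_inj_on[OF i])
  moreover have "A.ladder i (d - 2 * i) ` flag_meet d E Es i i \<subseteq> flag_meet d E Es (d - i) (d - i)"
    using ladder_flag_meet[of _ i "d - 2 * i"] i by auto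
  ultimately show ?thesis using dim_subset by metis
qed

text \<open>
  Exchanging the two maps and reversing both orders turns \<open>U\<^sub>i\<close> into \<open>U\<^bsub>d-i\<^esub>\<close>. The exchanged pair
  therefore provides an injection in the opposite direction, and the two dimensions agree.
\<close>

lemma ladder_surj:
  assumes i: "2 * i \<le> d"
  shows "A.ladder i (d - 2 * i) ` flag_meet d E Es i i = flag_meet d E Es (d - i) (d - i)"
proof (rule subspace_dim_equal)
  interpret pair: finite_dimensional_vector_space_pair sc Basis sc Basis by unfold_locales
  interpret dual: tridiagonal_resolution sc Basis d As "\<lambda>i. Es (d - i)" "\<lambda>i. \<theta>s (d - i)"
      A "\<lambda>i. E (d - i)" "\<lambda>i. \<theta> (d - i)"
    by (rule tridiagonal_resolution.swap[OF reverse_both])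
  have flip: "flag_meet d (\<lambda>i. Es (d - i)) (\<lambda>i. E (d - i)) j j = flag_meet d E Es (d - j) (d - j)"
    if "j \<le> d" for j
  proof -
    have "spectral_sum d E {k. d - k \<in> {..j}} = spectral_sum d E {d - j..}"
      "spectral_sum d Es {k. d - k \<in> {j..}} = spectral_sum d Es {..d - j}"
      using that by (auto intro!: antisym spectral_sum_mono)
    then show ?thesis unfolding flag_meet_def spectral_sum_rev by auto
  qed
  have sp: "span (flag_meet d E Es i i) = flag_meet d E Es i i"
    using subspace_flag_meet by (simp add: span_eq_iff)
  have eq: "dim (A.ladder i (d - 2 * i) ` flag_meet d E Es i i) = dim (flag_meet d E Es i i)"
    by (rule pair.dim_image_eq[OF A.linear_ladder]) (simp only: sp ladder_inj_on[OF i])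
  show "dim (flag_meet d E Es (d - i) (d - i)) \<le> dim (A.ladder i (d - 2 * i) ` flag_meet d E Es i i)"
    using dual.dim_le_via_ladder[OF i] i by (simp add: flip eq)
  show "subspace (A.ladder i (d - 2 * i) ` flag_meet d E Es i i)"
    using module_hom.subspace_image[OF linear_module_hom[OF A.linear_ladder] subspace_flag_meet] .
  show "A.ladder i (d - 2 * i) ` flag_meet d E Es i i \<subseteq> flag_meet d E Es (d - i) (d - i)"
    using ladder_flag_meet[of _ i "d - 2 * i"] i by auto
qed (rule subspace_flag_meet)

text \<open>
  The spaces in the last hypothesis are the \<open>K\<^sub>i\<close>. A vector \<open>u\<close> of \<open>U\<^bsub>i+1\<^esub>\<close> is corrected by an element of
  \<open>(A - \<theta>\<^sub>i)U\<^sub>i\<close> so that its image in \<open>U\<^bsub>d-i\<^esub>\<close> vanishes; that the correction exists is the surjectivity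
  of \<open>U\<^sub>i \<rightarrow> U\<^bsub>d-i\<^esub>\<close>, and the corrected vector lies in \<open>K\<^bsub>i+1\<^esub>\<close>.
\<close>

lemma K_spaces_generate:
  assumes D: "subspace D" "A ` D \<subseteq> D"
    and low: "\<And>i. 2 * i \<le> d \<Longrightarrow> spectral_sum d Es {..i} \<inter> spectral_sum d E {i..d - i} \<subseteq> D"
  shows "D = UNIV"
proof -
  have lower_half: "flag_meet d E Es i i \<subseteq> D" if "2 * i \<le> d" for i
    using that
  proof (induction i)
    case 0
    have "spectral_sum d E {0..} = UNIV" "spectral_sum d E {0..d - 0} = UNIV"
      by (simp_all add: A.spectral_sum_all subset_eq)
    then have "flag_meet d E Es 0 0 = spectral_sum d Es {..0} \<inter> spectral_sum d E {0..d - 0}"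
      by (simp add: flag_meet_def)
    then show ?case using low[of 0] by simp
  next
    case (Suc i)
    then have i: "2 * i \<le> d" and IH: "flag_meet d E Es i i \<subseteq> D" by auto
    show ?case
    proof
      fix u assume u: "u \<in> flag_meet d E Es (Suc i) (Suc i)"
      define n where "n = d - 2 * i - 1"
      have n: "d - 2 * i = Suc n" "Suc i + n = d - i" using Suc.prems by (auto simp: n_def)
      have "A.ladder (Suc i) n u \<in> flag_meet d E Es (d - i) (d - i)"
        using ladder_flag_meet[OF u, of n] n by simp
      then have "A.ladder (Suc i) n u \<in> A.ladder i (Suc n) ` flag_meet d E Es i i"
        using ladder_surj[OF i] by (simp only: n(1))
      then obtain w where w: "w \<in> flag_meet d E Es i i"
        and eq: "A.ladder i (Suc n) w = A.ladder (Suc i) n u"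
        by (metis imageE)
      (* w is the preimage of the image of u, and w' the correction of u. *)
      define w' where "w' = A w - sc (\<theta> i) w"
      have split: "A.ladder i (Suc m) w = A.ladder (Suc i) m w'" for m
        by (induction m) (simp_all add: w'_def)
      have w'U: "w' \<in> flag_meet d E Es (Suc i) (Suc i)"
        unfolding w'_def by (rule raise_flag_meet[OF w]) (use i in simp)
      have "w \<in> D" using IH w by blast
      moreover from this have "A w \<in> D" using D(2) by blast
      ultimately have w'D: "w' \<in> D"
        unfolding w'_def using D(1) by (intro subspace_diff subspace_scale)
      have uw: "u - w' \<in> flag_meet d E Es (Suc i) (Suc i)"
        using subspace_diff[OF subspace_flag_meet u w'U] .
      have "A.ladder (Suc i) n (u - w') = 0"
        unfolding linear_diff[OF A.linear_ladder] eq[symmetric] split by simp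
      then have "A.ladder (Suc i) n (u - w') \<in> spectral_sum d E {}"
        using subspace_0[OF A.subspace_spectral_sum] by metis
      then have "u - w' \<in> spectral_sum d E {Suc i..<d - i}"
        using A.ladder_spectral_sum[of "Suc i" n "u - w'" "{}"] n by simp
      moreover have "{Suc i..<d - i} = {Suc i..d - Suc i}" using Suc.prems by auto
      ultimately have "u - w' \<in> spectral_sum d Es {..Suc i} \<inter> spectral_sum d E {Suc i..d - Suc i}"
        using uw by (simp add: flag_meet_def)
      then have "u - w' \<in> D" using low[OF Suc.prems] by blast
      then have "(u - w') + w' \<in> D" using w'D D(1) by (intro subspace_add)
      then show "u \<in> D" by simp
    qed
  qed
  have "flag_meet d E Es i i \<subseteq> D" if "i \<le> d" for i
  proof (cases "2 * i \<le> d")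
    case False
    then have half: "2 * (d - i) \<le> d" by simp
    have "flag_meet d E Es i i
        = A.ladder (d - i) (d - 2 * (d - i)) ` flag_meet d E Es (d - i) (d - i)"
      using ladder_surj[OF half] that by simp
    also have "\<dots> \<subseteq> D"
      using lower_half[OF half] by (intro image_subsetI A.ladder_closed[OF D]) (rule subsetD)
    finally show ?thesis .
  qed (rule lower_half)
  then have "(\<Union>i\<le>d. flag_meet d E Es i i) \<subseteq> D" by blast
  then have "span (\<Union>i\<le>d. flag_meet d E Es i i) \<subseteq> D" using D(1) by (rule span_minimal)
  then show ?thesis using flag_meet_span_UNIV by auto
qed

end


section \<open>Tridiagonal systems as pairs of resolutions\<close>

lemma (in vector_space) subspace_eigenspace:
  assumes "Vector_Spaces.linear scale scale A"
  shows "subspace (eigenspace scale A \<theta>)"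
  unfolding eigenspace_def subspace_def
  by (simp add: linear_zero[OF assms] linear_add[OF assms] linear_scale[OF assms]
      scale_right_distrib scale_left_commute)

lemma (in vector_space) subspace_linear_preimage:
  assumes "Vector_Spaces.linear scale scale A" and "subspace W"
  shows "subspace {v. A v \<in> W}"
  using assms(2) unfolding subspace_def
  by (simp add: linear_zero[OF assms(1)] linear_add[OF assms(1)] linear_scale[OF assms(1)])

text \<open>
  A primitive idempotent is prescribed only on the eigenspaces. Since these span, each identity to
  be shown needs checking there only: the vectors satisfying it form a subspace.
\<close>

lemma standard_idempotents_resolution:
  fixes sc :: "'k::field \<Rightarrow> 'v::ab_group_add \<Rightarrow> 'v"
  assumes vs: "vector_space sc"
    and diag: "diagonalizable_map sc A" and As: "Vector_Spaces.linear sc sc As"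
    and std: "standard_idempotents sc A As d E"
  obtains \<theta> where "spectral_resolution sc d A E \<theta>"
    and "\<And>i j v. i \<le> d \<Longrightarrow> j \<le> d \<Longrightarrow> Suc i < j \<or> Suc j < i \<Longrightarrow> E i (As (E j v)) = 0"
proof -
  interpret vector_space sc by (rule vs)
  have A: "Vector_Spaces.linear sc sc A" and span: "span (\<Union>(eigenspaces sc A)) = UNIV"
    using diag by (simp_all add: diagonalizable_map_def)
  obtain W where ord: "standard_ordering sc A As d W"
    and prim: "\<And>i. i \<le> d \<Longrightarrow> primitive_idempotent sc A (W i) (E i)"
    using std by (auto simp: standard_idempotents_def)
  have bij: "bij_betw W {0..d} (eigenspaces sc A)" using ord by (simp add: standard_ordering_def)
  have spaces: "eigenspaces sc A = W ` {0..d}" using bij by (simp add: bij_betw_def)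
  have "\<exists>t. W i = eigenspace sc A t \<and> W i \<noteq> {0}" if "i \<le> d" for i
  proof -
    have "W i \<in> eigenspaces sc A" using that by (simp add: spaces)
    then show ?thesis by (auto simp: eigenspaces_def)
  qed
  then obtain \<theta> where \<theta>: "\<And>i. i \<le> d \<Longrightarrow> W i = eigenspace sc A (\<theta> i) \<and> W i \<noteq> {0}"
    by metis
  have sW: "subspace (W i)" if "i \<le> d" for i
    using \<theta>[OF that] subspace_eigenspace[OF A] by simp
  have W_inj: "W i = W j \<longleftrightarrow> i = j" if "i \<le> d" "j \<le> d" for i j
    using bij that by (auto simp: bij_betw_def inj_on_def)
  have lin: "Vector_Spaces.linear sc sc (E i)" if "i \<le> d" for i
    using prim[OF that] by (simp add: primitive_idempotent_def)
  have on_W: "E i w = (if i = j then w else 0)" if "i \<le> d" "j \<le> d" "w \<in> W j" for i j w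
    using prim[OF that(1)] that W_inj[of i j] spaces by (auto simp: primitive_idempotent_def)
  have everything: "v \<in> D" if "subspace D" "\<And>i. i \<le> d \<Longrightarrow> W i \<subseteq> D" for D v
  proof -
    have "\<Union>(eigenspaces sc A) \<subseteq> D" using that(2) unfolding spaces by fastforce
    then have "span (\<Union>(eigenspaces sc A)) \<subseteq> D" using that(1) by (rule span_minimal)
    then show ?thesis using span by auto
  qed
  have in_W: "E i v \<in> W i" if i: "i \<le> d" for i v
  proof -
    have "v \<in> {v. E i v \<in> W i}"
      using on_W i subspace_0[OF sW[OF i]]
      by (intro everything subspace_linear_preimage lin sW) auto
    then show ?thesis by simp
  qed
  have res: "spectral_resolution sc d A E \<theta>"
  proof (rule spectral_resolution.intro[OF vs], rule spectral_resolution_axioms.intro)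
    show "E i (E j v) = (if i = j then E i v else 0)" if "i \<le> d" "j \<le> d" for i j v
      using on_W[OF that in_W[OF that(2)]] by auto
    show "(\<Sum>i\<le>d. E i v) = v" for v
    proof -
      have "v \<in> {v. (\<Sum>i\<le>d. E i v) = v}"
      proof (rule everything)
        show "subspace {v. (\<Sum>i\<le>d. E i v) = v}"
          unfolding subspace_def
          by (simp add: linear_zero[OF lin] linear_add[OF lin] linear_scale[OF lin]
              sum.distrib flip: scale_sum_right)
        show "W j \<subseteq> {v. (\<Sum>i\<le>d. E i v) = v}" if "j \<le> d" for j
        proof
          fix w assume w: "w \<in> W j"
          have "(\<Sum>i\<le>d. E i w) = (\<Sum>i\<le>d. if i = j then w else 0)"
            using on_W that w by (intro sum.cong) auto
          then show "w \<in> {v. (\<Sum>i\<le>d. E i v) = v}" using that by simp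
        qed
      qed
      then show ?thesis by simp
    qed
    show "A (E i v) = sc (\<theta> i) (E i v)" if "i \<le> d" for i v
      using in_W[OF that, of v] \<theta>[OF that] by (auto simp: eigenspace_def)
    show "i = j" if "i \<le> d" "j \<le> d" "\<theta> i = \<theta> j" for i j
      using W_inj[OF that(1,2)] \<theta>[OF that(1)] \<theta>[OF that(2)] that(3) by auto
    show "\<exists>v. E i v \<noteq> 0" if i: "i \<le> d" for i
    proof -
      obtain w where "w \<in> W i" "w \<noteq> 0" using \<theta>[OF i] subspace_0[OF sW[OF i]] by blast
      then have "E i w \<noteq> 0" using on_W[OF i i] by simp
      then show ?thesis by blast
    qed
  qed (use A lin in auto)
  have far: "E i (As (E j v)) = 0"
    if i: "i \<le> d" and j: "j \<le> d" and ij: "Suc i < j \<or> Suc j < i" for i j v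
  proof -
    have "As (E j v) \<in> (if j = 0 then {0} else W (j - 1)) + W j + (if j = d then {0} else W (j + 1))"
      using ord j in_W[OF j, of v] unfolding standard_ordering_def by blast
    then obtain x y z where xyz: "As (E j v) = x + y + z"
      and x: "x \<in> (if j = 0 then {0} else W (j - 1))" and y: "y \<in> W j"
      and z: "z \<in> (if j = d then {0} else W (j + 1))"
      by (auto elim!: set_plus_elim)
    have "E i x = 0"
      using x on_W[of i "j - 1" x] i j ij by (auto simp: linear_zero[OF lin] split: if_splits)
    moreover have "E i y = 0" using y on_W[of i j y] i j ij by auto
    moreover have "E i z = 0"
      using z on_W[of i "j + 1" z] i j ij by (auto simp: linear_zero[OF lin] split: if_splits)
    ultimately show ?thesis by (simp add: xyz linear_add[OF lin[OF i]])
  qed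
  show ?thesis using that[OF res far] .
qed

lemma td_system_resolution:
  fixes sc :: "'k::field \<Rightarrow> 'v::ab_group_add \<Rightarrow> 'v"
  assumes V: "finite_dimensional_vector_space sc Basis"
    and td: "td_system sc d A E As Es"
  obtains \<theta> \<theta>s where "tridiagonal_resolution sc Basis d A E \<theta> As Es \<theta>s"
proof -
  interpret finite_dimensional_vector_space sc Basis by (rule V)
  have pair: "td_pair sc A As" and E: "standard_idempotents sc A As d E"
    and Es: "standard_idempotents sc As A d Es"
    using td by (simp_all add: td_system_def)
  have diag: "diagonalizable_map sc A" "diagonalizable_map sc As"
    using pair by (simp_all add: td_pair_def)
  have lin: "Vector_Spaces.linear sc sc A" "Vector_Spaces.linear sc sc As"
    using diag by (simp_all add: diagonalizable_map_def)
  obtain \<theta> where \<theta>: "spectral_resolution sc d A E \<theta>"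
    "\<And>i j v. i \<le> d \<Longrightarrow> j \<le> d \<Longrightarrow> Suc i < j \<or> Suc j < i \<Longrightarrow> E i (As (E j v)) = 0"
    using standard_idempotents_resolution[OF vector_space_axioms diag(1) lin(2) E] by blast
  obtain \<theta>s where \<theta>s: "spectral_resolution sc d As Es \<theta>s"
    "\<And>i j v. i \<le> d \<Longrightarrow> j \<le> d \<Longrightarrow> Suc i < j \<or> Suc j < i \<Longrightarrow> Es i (A (Es j v)) = 0"
    using standard_idempotents_resolution[OF vector_space_axioms diag(2) lin(1) Es] by blast
  have "W = {0} \<or> W = UNIV" if "subspace W" "A ` W \<subseteq> W" "As ` W \<subseteq> W" for W
    using pair that unfolding td_pair_def by blast
  then have "tridiagonal_resolution sc Basis d A E \<theta> As Es \<theta>s"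
    by (intro tridiagonal_resolution.intro[OF V \<theta>(1) \<theta>s(1)] tridiagonal_resolution_axioms.intro
        \<theta>(2) \<theta>s(2))
  then show ?thesis by (rule that)
qed

section \<open>The Casimir operator\<close>

text \<open>
  The defining relations of \<open>U\<^sub>q(sl\<^sub>2)\<close>, read as identities between operators.
\<close>

locale uq_action = vector_space sc
  for sc :: "'k::field \<Rightarrow> 'v::ab_group_add \<Rightarrow> 'v" +
  fixes q :: 'k and e f k ki :: "'v \<Rightarrow> 'v"
  assumes lin_e: "Vector_Spaces.linear sc sc e" and lin_f: "Vector_Spaces.linear sc sc f"
    and lin_k: "Vector_Spaces.linear sc sc k" and lin_ki: "Vector_Spaces.linear sc sc ki"
    and k_ki: "k (ki v) = v" and ki_k: "ki (k v) = v"
    and k_e_ki: "k (e (ki v)) = sc (q\<^sup>2) (e v)"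
    and k_f_ki: "k (f (ki v)) = sc (inverse (q\<^sup>2)) (f v)"
    and e_f: "e (f v) - f (e v) = sc (inverse (q - inverse q)) (k v - ki v)"
    and q_nonzero: "q \<noteq> 0" and q_generic: "q - inverse q \<noteq> 0"
begin

definition casimir_map :: "'v \<Rightarrow> 'v" where
  "casimir_map v = sc ((q - inverse q)\<^sup>2) (e (f v)) + sc (inverse q) (k v) + sc q (ki v)"

lemmas lins = linear_add[OF lin_e] linear_add[OF lin_f] linear_add[OF lin_k] linear_add[OF lin_ki]
  linear_diff[OF lin_e] linear_diff[OF lin_f] linear_diff[OF lin_k] linear_diff[OF lin_ki]
  linear_scale[OF lin_e] linear_scale[OF lin_f] linear_scale[OF lin_k] linear_scale[OF lin_ki]

lemma linear_casimir_map: "Vector_Spaces.linear sc sc casimir_map"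
  by unfold_locales
    (simp_all add: casimir_map_def lins scale_right_distrib ac_simps)

lemma k_e: "k (e v) = sc (q\<^sup>2) (e (k v))"
  using k_e_ki[of "k v"] by (simp add: ki_k)

lemma k_f: "k (f v) = sc (inverse (q\<^sup>2)) (f (k v))"
  using k_f_ki[of "k v"] by (simp add: ki_k)

lemma ki_f: "ki (f v) = sc (q\<^sup>2) (f (ki v))"
proof -
  have "f (ki v) = ki (k (f (ki v)))" by (simp add: ki_k)
  also have "\<dots> = sc (inverse (q\<^sup>2)) (ki (f v))" by (simp only: k_f_ki lins)
  finally show ?thesis using q_nonzero by simp
qed

lemma casimir_map_k: "casimir_map (k v) = k (casimir_map v)"
  using q_nonzero by (simp add: casimir_map_def lins k_e k_f k_ki ki_k)

lemma casimir_map_ki: "casimir_map (ki v) = ki (casimir_map v)"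
  using casimir_map_k[of "ki v"] by (metis k_ki ki_k)

text \<open>
  The second normal form of the Casimir element, with \<open>f\<close> to the left of \<open>e\<close>. Comparing it with the
  first one makes the centrality visible: multiplying \<open>f\<close> on the right of this form and on the left
  of the other gives \<open>fef\<close> in both.
\<close>

lemma casimir_map_alt:
  "casimir_map v = sc ((q - inverse q)\<^sup>2) (f (e v)) + sc q (k v) + sc (inverse q) (ki v)"
proof -
  let ?n = "q - inverse q"
  have "e (f v) = f (e v) + sc (inverse ?n) (k v - ki v)" using e_f[of v] by (simp add: algebra_simps)
  then have "sc (?n\<^sup>2) (e (f v)) = sc (?n\<^sup>2) (f (e v)) + sc ?n (k v - ki v)"
    using q_generic by (simp add: scale_right_distrib power2_eq_square)
  then show ?thesis
    by (simp add: casimir_map_def scale_right_diff_distrib scale_left_diff_distrib)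
qed

lemma casimir_map_f: "casimir_map (f v) = f (casimir_map v)"
proof -
  have "casimir_map (f v) = sc ((q - inverse q)\<^sup>2) (f (e (f v))) + sc q (k (f v))
      + sc (inverse q) (ki (f v))" by (rule casimir_map_alt)
  also have "\<dots> = f (casimir_map v)"
    using q_nonzero by (simp add: casimir_map_def lins k_f ki_f power2_eq_square field_simps)
  finally show ?thesis .
qed

lemma casimir_map_highest_weight:
  assumes e: "e v = 0" and k: "k v = sc t v" and t: "t \<noteq> 0"
  shows "casimir_map v = sc (q * t + inverse q * inverse t) v"
proof -
  have "sc (inverse t) v = sc (inverse t) (ki (k v))" by (simp add: ki_k)
  also have "\<dots> = ki v" using t by (simp add: k lins)
  finally have "ki v = sc (inverse t) v" by simp
  then show ?thesis
    using linear_zero[OF lin_f] by (simp add: casimir_map_alt e k scale_left_distrib)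
qed

end

section \<open>Representations of the quantum enveloping algebra\<close>

lemma ring_free_ring: "ring (free_ring :: 'k::field uq_free ring)"
proof (rule ringI)
  show "abelian_group (free_ring :: 'k uq_free ring)"
  proof (rule abelian_groupI)
    fix x :: "'k uq_free"
    show "\<exists>y\<in>carrier free_ring. y \<oplus>\<^bsub>free_ring\<^esub> x = \<zero>\<^bsub>free_ring\<^esub>"
      by (rule bexI[of _ "- x"]) (simp_all add: free_ring_def)
  qed (simp_all add: free_ring_def add_ac)
  show "Group.monoid (free_ring :: 'k uq_free ring)"
    by (rule monoidI) (simp_all add: free_ring_def mult.assoc)
qed (simp_all add: free_ring_def algebra_simps)

lemma ideal_uq_ideal: "ideal (uq_ideal q) free_ring"
  unfolding uq_ideal_def
  by (rule ring.genideal_ideal[OF ring_free_ring]) (simp add: free_ring_def)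

lemma uq_class_add: "uq_class q x <+>\<^bsub>free_ring\<^esub> uq_class q y = uq_class q (x + y)"
proof -
  interpret ideal "uq_ideal q" "free_ring :: 'a uq_free ring" by (rule ideal_uq_ideal)
  show ?thesis using a_rcos_sum[of x y] by (simp add: uq_class_def free_ring_def)
qed

lemma uq_class_mult:
  "rcoset_mult free_ring (uq_ideal q) (uq_class q x) (uq_class q y) = uq_class q (x * y)"
proof -
  interpret ideal "uq_ideal q" "free_ring :: 'a uq_free ring" by (rule ideal_uq_ideal)
  show ?thesis using rcoset_mult_add[of x y] by (simp add: uq_class_def free_ring_def)
qed

lemma uq_class_relator:
  assumes "x \<in> uq_relators q"
  shows "uq_class q x = uq_class q 0"
proof -
  interpret ideal "uq_ideal q" "free_ring :: 'a uq_free ring" by (rule ideal_uq_ideal)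
  have "x \<in> uq_ideal q"
    using ring.genideal_self[OF ring_free_ring, of "uq_relators q"] assms
    unfolding uq_ideal_def by (auto simp: free_ring_def)
  then have "uq_class q x = uq_ideal q" unfolding uq_class_def by (rule a_rcos_const)
  moreover have "uq_class q 0 = uq_ideal q"
    unfolding uq_class_def using a_subset additive_subgroup.zero_closed[OF additive_subgroup_axioms]
    by (intro a_rcos_const) (simp add: free_ring_def)
  ultimately show ?thesis by simp
qed

lemma uq_class_closed: "uq_class q x \<in> carrier (Uq_sl2 q)"
proof -
  interpret ideal "uq_ideal q" "free_ring :: 'a uq_free ring" by (rule ideal_uq_ideal)
  show ?thesis unfolding Uq_sl2_def FactRing_def uq_class_def
    using a_rcosetsI[OF a_subset, of x] by (simp add: free_ring_def)
qed

locale uq_representation = vector_space sc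
  for sc :: "'k::field \<Rightarrow> 'v::ab_group_add \<Rightarrow> 'v" +
  fixes q :: 'k and \<rho> :: "'k uq_free set \<Rightarrow> 'v \<Rightarrow> 'v"
  assumes uq_module: "uq_module sc q \<rho>"
begin

abbreviation act :: "'k uq_free \<Rightarrow> 'v \<Rightarrow> 'v" where
  "act x \<equiv> \<rho> (uq_class q x)"

lemma hom: "\<rho> \<in> ring_hom (Uq_sl2 q) (End_ring sc)"
  using uq_module by (simp add: uq_module_def)

lemma act_scal: "act (scal c) = sc c"
  using uq_module by (simp add: uq_module_def)

lemma linear_act: "Vector_Spaces.linear sc sc (act x)"
  using ring_hom_closed[OF hom uq_class_closed, of x] by (simp add: End_ring_def)

lemma act_mult: "act (x * y) v = act x (act y v)"
  using ring_hom_mult[OF hom uq_class_closed uq_class_closed, of x y]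
  by (simp add: End_ring_def Uq_sl2_def FactRing_def uq_class_mult)

lemma act_add: "act (x + y) v = act x v + act y v"
  using ring_hom_add[OF hom uq_class_closed uq_class_closed, of x y]
  by (simp add: End_ring_def Uq_sl2_def FactRing_def uq_class_add)

lemma act_one: "act 1 v = v"
  using act_scal[of 1] by (simp add: scal_def flip: single_one)

lemma act_zero: "act 0 v = 0"
  using act_scal[of 0] by (simp add: scal_def)

lemma act_diff: "act (x - y) v = act x v - act y v"
  using act_add[of "x - y" y v] by simp

lemmas act_simps = act_scal act_mult act_add act_one act_zero act_diff

lemma act_relator: "x \<in> uq_relators q \<Longrightarrow> act x v = 0"
  by (simp add: uq_class_relator act_zero)

lemma uq_action_gens:
  assumes "q \<noteq> 0" "q - inverse q \<noteq> 0"
  shows "uq_action sc q (act (gen Gen_e)) (act (gen Gen_f)) (act (gen Gen_k)) (act (gen Gen_kinv))"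
proof (rule uq_action.intro[OF vector_space_axioms], rule uq_action_axioms.intro)
  fix v
  note rel = act_relator[of _ v, unfolded uq_relators_def]
  show "act (gen Gen_k) (act (gen Gen_kinv) v) = v"
    using rel[of "gen Gen_k * gen Gen_kinv - 1"] by (simp add: act_simps)
  show "act (gen Gen_kinv) (act (gen Gen_k) v) = v"
    using rel[of "gen Gen_kinv * gen Gen_k - 1"] by (simp add: act_simps)
  show "act (gen Gen_k) (act (gen Gen_e) (act (gen Gen_kinv) v)) = sc (q\<^sup>2) (act (gen Gen_e) v)"
    using rel[of "gen Gen_k * gen Gen_e * gen Gen_kinv - scal (q\<^sup>2) * gen Gen_e"]
    by (simp add: act_simps)
  show "act (gen Gen_k) (act (gen Gen_f) (act (gen Gen_kinv) v))
      = sc (inverse (q\<^sup>2)) (act (gen Gen_f) v)"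
    using rel[of "gen Gen_k * gen Gen_f * gen Gen_kinv - scal (inverse (q\<^sup>2)) * gen Gen_f"]
    by (simp add: act_simps)
  show "act (gen Gen_e) (act (gen Gen_f) v) - act (gen Gen_f) (act (gen Gen_e) v)
      = sc (inverse (q - inverse q)) (act (gen Gen_k) v - act (gen Gen_kinv) v)"
    using rel[of "gen Gen_e * gen Gen_f - gen Gen_f * gen Gen_e
        - scal (inverse (q - inverse q)) * (gen Gen_k - gen Gen_kinv)"]
    by (simp add: act_simps)
qed (use assms linear_act in auto)

end

lemma uq_module_via_casimir:
  fixes sc :: "'k::field \<Rightarrow> 'v::ab_group_add \<Rightarrow> 'v"
  assumes "vector_space sc" and \<rho>: "uq_module_via sc q \<rho> e f k ki"
    and q: "q \<noteq> 0" "q - inverse q \<noteq> 0"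
  shows "uq_action sc q e f k ki" and "\<rho> (casimir q) = uq_action.casimir_map sc q e f k ki"
proof -
  have mod: "uq_module sc q \<rho>" and gens:
    "\<rho> (uq_class q (gen Gen_e)) = e" "\<rho> (uq_class q (gen Gen_f)) = f"
    "\<rho> (uq_class q (gen Gen_k)) = k" "\<rho> (uq_class q (gen Gen_kinv)) = ki"
    using \<rho> by (simp_all add: uq_module_via_def)
  interpret uq_representation sc q \<rho>
    by (rule uq_representation.intro[OF assms(1)], rule uq_representation_axioms.intro[OF mod])
  show action: "uq_action sc q e f k ki" using uq_action_gens[OF q] by (simp add: gens)
  show "\<rho> (casimir q) = uq_action.casimir_map sc q e f k ki"
    by (rule ext)
      (simp add: casimir_def act_simps gens mult.assoc uq_action.casimir_map_def[OF action])
qed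

section \<open>Comparison of the two Casimir actions\<close>

theorem lemma9p1:
  fixes sc :: "'k::alg_closed_field \<Rightarrow> 'v::ab_group_add \<Rightarrow> 'v"
    and Basis :: "'v set"
    and d :: nat
    and A As :: "'v \<Rightarrow> 'v"
    and E Es :: "nat \<Rightarrow> 'v \<Rightarrow> 'v"
    and q a b :: 'k
    and K B R R_down \<psi> :: "'v \<Rightarrow> 'v"
    and \<rho> \<rho>' :: "'k uq_free set \<Rightarrow> 'v \<Rightarrow> 'v"
  assumes V: "finite_dimensional_vector_space sc Basis" "\<exists>v::'v. v \<noteq> 0"
    and d: "d \<ge> 1"
    and \<Phi>: "td_system sc d A E As Es" "q_racah_type sc d A E As Es q a b"
    and K: "acts_on_decomposition sc d q (split_U d E Es) K"
    and B: "acts_on_decomposition sc d q (split_U_down d E Es) B"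
    and R: "R = (\<lambda>v. A v - sc a (K v) - sc (inverse a) (inv_into UNIV K v))"
    and R_down: "R_down = (\<lambda>v. A v - sc (inverse a) (B v) - sc a (inv_into UNIV B v))"
    and \<psi>: "is_psi sc d E Es q K R \<psi>"
    and module_i: "uq_module_via sc q \<rho>
           (\<lambda>v. sc (inverse (q - inverse q)) (\<psi> v))
           (\<lambda>v. sc (inverse (q - inverse q)) (R v)) K (inv_into UNIV K)"
    and module_ii: "uq_module_via sc q \<rho>'
           (\<lambda>v. sc (inverse (q - inverse q)) (\<psi> v))
           (\<lambda>v. sc (inverse (q - inverse q)) (R_down v)) B (inv_into UNIV B)"
  shows "\<rho> (casimir q) = \<rho>' (casimir q)"
proof -
  obtain \<theta> \<theta>s where "tridiagonal_resolution sc Basis d A E \<theta> As Es \<theta>s"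
    using td_system_resolution[OF V(1) \<Phi>(1)] .
  then interpret tridiagonal_resolution sc Basis d A E \<theta> As Es \<theta>s .
  define n where "n = q - inverse q"
  have q: "q \<noteq> 0" and q4: "q ^ 4 \<noteq> 1" using \<Phi>(2) by (simp_all add: q_racah_type_def)
  (* The commutator relation divides by q - 1/q. *)
  have "q * q \<noteq> 1"
  proof
    assume "q * q = 1"
    moreover have "q ^ 4 = (q * q) * (q * q)" by (simp add: power4_eq_xxxx mult.assoc)
    ultimately show False using q4 by simp
  qed
  then have n: "n \<noteq> 0" using q by (auto simp: n_def field_simps)
  define e where "e = (\<lambda>v. sc (inverse n) (\<psi> v))"
  define f where "f = (\<lambda>v. sc (inverse n) (R v))"
  define f' where "f' = (\<lambda>v. sc (inverse n) (R_down v))"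
  interpret U: uq_action sc q e f K "inv_into UNIV K"
    using uq_module_via_casimir(1)[OF vector_space_axioms module_i q] n
    by (simp add: n_def e_def f_def)
  interpret U': uq_action sc q e f' B "inv_into UNIV B"
    using uq_module_via_casimir(1)[OF vector_space_axioms module_ii q] n
    by (simp add: n_def e_def f'_def)
  have \<rho>: "\<rho> (casimir q) = U.casimir_map"
    using uq_module_via_casimir(2)[OF vector_space_axioms module_i q] n
    by (simp add: n_def e_def f_def)
  have \<rho>': "\<rho>' (casimir q) = U'.casimir_map"
    using uq_module_via_casimir(2)[OF vector_space_axioms module_ii q] n
    by (simp add: n_def e_def f'_def)
  (* A belongs to the span of the actions of f, k and the inverse of k on both sides. *)
  have A_i: "A v = sc n (f v) + sc a (K v) + sc (inverse a) (inv_into UNIV K v)" for v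
    using n by (simp add: f_def R)
  have A_ii: "A v = sc n (f' v) + sc (inverse a) (B v) + sc a (inv_into UNIV B v)" for v
    using n by (simp add: f'_def R_down)
  have comm: "U.casimir_map (A v) = A (U.casimir_map v)" for v
    by (simp add: A_i linear_add[OF U.linear_casimir_map] linear_scale[OF U.linear_casimir_map]
        U.casimir_map_f U.casimir_map_k U.casimir_map_ki)
  have comm': "U'.casimir_map (A v) = A (U'.casimir_map v)" for v
    by (simp add: A_ii linear_add[OF U'.linear_casimir_map] linear_scale[OF U'.linear_casimir_map]
        U'.casimir_map_f U'.casimir_map_k U'.casimir_map_ki)
  define D where "D = {v. U.casimir_map v = U'.casimir_map v}"
  have "D = UNIV"
  proof (rule K_spaces_generate)
    show "subspace D"
      unfolding D_def subspace_def
      by (simp add: linear_zero[OF U.linear_casimir_map] linear_zero[OF U'.linear_casimir_map]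
          linear_add[OF U.linear_casimir_map] linear_add[OF U'.linear_casimir_map]
          linear_scale[OF U.linear_casimir_map] linear_scale[OF U'.linear_casimir_map])
    show "A ` D \<subseteq> D" by (auto simp: D_def comm comm')
    fix i assume i: "2 * i \<le> d"
    show "spectral_sum d Es {..i} \<inter> spectral_sum d E {i..d - i} \<subseteq> D"
    proof
      fix v assume v: "v \<in> spectral_sum d Es {..i} \<inter> spectral_sum d E {i..d - i}"
      have Es: "(\<Sum>j\<in>{0..i}. range (Es j)) = spectral_sum d Es {..i}"
        using As.sum_ranges_eq_spectral_sum[of "{0..i}"] i by (simp add: atLeast0AtMost)
      have E: "(\<Sum>j\<in>J. range (E j)) = spectral_sum d E J" if "J \<subseteq> {..d}" for J
        using A.sum_ranges_eq_spectral_sum[OF that] .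
      have "v \<in> spectral_sum d E {i..d}" "v \<in> spectral_sum d E {0..d - i}"
        using v by (auto elim!: spectral_sum_weaken)
      then have in_U: "v \<in> split_U d E Es i" "v \<in> split_U_down d E Es i" "v \<in> K_space d E Es i"
        using v unfolding split_U_def split_U_down_def K_space_def by (subst E, auto simp: Es)+
      let ?t = "q powi (int d - 2 * int i)"
      have "e v = 0" using \<psi> in_U(3) i by (simp add: is_psi_def e_def)
      moreover have "K v = sc ?t v" "B v = sc ?t v"
        using K B in_U(1,2) i by (simp_all add: acts_on_decomposition_def)
      moreover have "?t \<noteq> 0" using q by simp
      ultimately have "U.casimir_map v = U'.casimir_map v"
        using U.casimir_map_highest_weight[of v ?t] U'.casimir_map_highest_weight[of v ?t]
        by metis
      then show "v \<in> D" by (simp add: D_def)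
    qed
  qed
  then show ?thesis by (auto simp: \<rho> \<rho>' D_def)
qed

end
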